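(* Let $A = (L, C, \to, \ell_0)$ be a timed automaton with maximal constant $MC$ and let $\ell_g \in L$. The following (nondeterministic) time-dart reachability algorithm terminates, and it returns true if and only if $\ell_g$ is reachable in the discrete semantics $T_{DS}(A)$, for every resolution of its nondeterministic choices. Algorithm: the passed-waiting list is a function $PW : L \times \mathcal{A}(C) \to (\mathbb{N} \times \mathbb{N}_\infty) \cup \{\bot\}$, initially $\bot$ everywhere. Call AddToPW$(\ell_0, \alpha_0, 0, \infty)$, where $\alpha_0(x) = 0$ for all $x$. While there exists $(\ell, \alpha)$ with $PW(\ell,\alpha) = (w,p)$ and $w < p$: pick any such $(\ell,\alpha)$; set $PW(\ell,\alpha) := (w,w)$; then for each edge $(\ell, g, R, \ell') \in \to$ starting in $\ell$: - $start := \max\{w, \max\{\mathrm{lb}(g(x)) - \alpha(x) \mid x \in C\}\}$; - $end := \min\{\mathrm{ub}(g(x)) - \alpha(x) \mid x \in C\}$ (where $\infty - n = \infty$); - if $start < p$ and $start \le end$: - if $R = \emptyset$, call AddToPW$(\ell', (\alpha \oplus_{MC} start) - start, start, \infty)$, where subtracting $start$ from a valuation subtracts it from every clock; - otherwise let $stop := \max\{start, MC + 1 - \min_{x \in C \setminus R} \alpha(x)\}$ (with $\min \emptyset = \infty$, so $stop = start$ when $R = C$), and for $n = start, start+1, \dots, \min\{end, p-1, stop\}$ call AddToPW$(\ell', (\alpha \oplus_{MC} n)[R:=0], 0, \infty)$. When the while-loop ends, return false. Procedure AddToPW$(\ell, \alpha, w, p)$: if $\ell = \ell_g$, return true and terminate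 the whole algorithm. Otherwise, if $PW(\ell,\alpha) = \bot$ set $PW(\ell,\alpha) := (w,p)$; else, with $(w',p') := PW(\ell,\alpha)$, set $PW(\ell,\alpha) := (\min\{w,w'\}, \min\{p,p'\})$.
   Context: $\mathbb{N}$ denotes the nonnegative integers and $\mathbb{N}_\infty = \mathbb{N}\cup\{\infty\}$, with $n<\infty$ and $n+\infty=\infty$. A time interval is $[a,b]$ or $[a,\infty)$ with $a \le b$ in $\mathbb{N}$; $\mathrm{lb}$ and $\mathrm{ub}$ give its lower and upper bound ($b$, resp. $\infty$). A clock guard over a finite clock set $C$ assigns a time interval $g(x)$ to each $x \in C$; a valuation $v : C \to \mathbb{N}$ satisfies $g$ if $v(x) \in g(x)$ for all $x$. A timed automaton is $A = (L, C, \to, \ell_0)$ with $L$ a finite set of locations, $C$ a finite set of clocks, $\to$ a finite set of edges $(\ell,g,R,\ell')$, also written $\ell \xrightarrow{g,R} \ell'$ ($g$ a clock guard, $R \subseteq C$), and initial location $\ell_0$. $MC$ is the largest integer appearing in any guard of $A$. For a valuation $v$: $(v+d)(x)=v(x)+d$; $v[R:=0](x)=0$ for $x\in R$ and $v(x)$ otherwise. Bounded addition: $n \oplus_{MC} m = MC+1$ if $n+m > MC$ and $n+m$ otherwise, applied pointwise to valuations. An anchor point is a valuation $\alpha : C \to \mathbb{N}$ with $\alpha(x) = 0$ for at least one $x \in C$; $\mathcal{A}(C)$ is the set of anchor points. The discrete semantics $T_{DS}(A)$ has states $(\ell,v)$ and transitions $(\ell,v)\xrightarrow{\tau}(\ell',v[R:=0])$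 for each edge $\ell\xrightarrow{g,R}\ell'$ with $v\models g$, and $(\ell,v)\xrightarrow{d}(\ell,v+d)$ for $d\in\mathbb{N}$. A location $\ell_g$ is reachable in $T_{DS}(A)$ if $(\ell_0,v_0)\to^*(\ell_g,v)$ for some $v$, where $v_0 \equiv 0$ and $\to^*$ is the reflexive-transitive closure of the union of all transitions. *)

theory Defs
  imports "HOL-Library.Extended_Real"
begin

section \<open>Timed automata and their discrete semantics\<close>

text \<open>The sets of locations and clocks are finite types \<open>'l\<close> and \<open>'c\<close>. The side condition
  \<open>a \<le> b\<close> on an interval from \<open>a\<close> to \<open>b\<close> is part of \<open>timed_automaton\<close>.\<close>

datatype interval = Interval (lb: nat) (ub: enat)

definition points :: "interval \<Rightarrow> nat set" where
  "points I = {n. lb I \<le> n \<and> enat n \<le> ub I}"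

type_synonym 'c valuation = "'c \<Rightarrow> nat"
type_synonym 'c guard = "'c \<Rightarrow> interval"
type_synonym ('l, 'c) edge = "'l \<times> 'c guard \<times> 'c set \<times> 'l"

record ('l, 'c) ta =
  edges :: "('l, 'c) edge set"
  init_loc :: 'l

definition timed_automaton :: "('l::finite, 'c::finite) ta \<Rightarrow> bool" where
  "timed_automaton A \<longleftrightarrow> finite (edges A) \<and>
     (\<forall>(l, g, R, l') \<in> edges A. \<forall>x. enat (lb (g x)) \<le> ub (g x))"

definition sat :: "'c valuation \<Rightarrow> 'c guard \<Rightarrow> bool" where
  "sat v g \<longleftrightarrow> (\<forall>x. v x \<in> points (g x))"

definition delay :: "'c valuation \<Rightarrow> nat \<Rightarrow> 'c valuation" where
  "delay v d = (\<lambda>x. v x + d)"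

definition reset :: "'c valuation \<Rightarrow> 'c set \<Rightarrow> 'c valuation" where
  "reset v R = (\<lambda>x. if x \<in> R then 0 else v x)"

datatype label = Tau | Delay nat

inductive ds_trans ::
  "('l, 'c) ta \<Rightarrow> 'l \<times> 'c valuation \<Rightarrow> label \<Rightarrow> 'l \<times> 'c valuation \<Rightarrow> bool" for A where
  tau: "(l, g, R, l') \<in> edges A \<Longrightarrow> sat v g \<Longrightarrow> ds_trans A (l, v) Tau (l', reset v R)"
| del: "ds_trans A (l, v) (Delay d) (l, delay v d)"

definition ds_reachable :: "('l, 'c) ta \<Rightarrow> 'l \<Rightarrow> bool" where
  "ds_reachable A l \<longleftrightarrow>
     (\<exists>v. (\<lambda>s s'. \<exists>a. ds_trans A s a s')\<^sup>*\<^sup>* (init_loc A, \<lambda>_. 0) (l, v))"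

definition guard_constants :: "('l, 'c) ta \<Rightarrow> nat set" where
  "guard_constants A = {n. \<exists>(l, g, R, l') \<in> edges A. \<exists>x. n = lb (g x) \<or> enat n = ub (g x)}"

text \<open>Inserting \<open>0\<close> only matters for an automaton without edges.\<close>

definition max_const :: "('l, 'c) ta \<Rightarrow> nat" where
  "max_const A = Max (insert 0 (guard_constants A))"

definition anchor_points :: "'c valuation set" where
  "anchor_points = {\<alpha>. \<exists>x. \<alpha> x = 0}"

definition bounded_add :: "nat \<Rightarrow> nat \<Rightarrow> nat \<Rightarrow> nat" where
  "bounded_add MC n m = (if n + m > MC then MC + 1 else n + m)"

definition bounded_delay :: "nat \<Rightarrow> 'c valuation \<Rightarrow> nat \<Rightarrow> 'c valuation" where
  "bounded_delay MC v d = (\<lambda>x. bounded_add MC (v x) d)"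


section \<open>The time-dart algorithm\<close>

text \<open>\<open>None\<close> is the value \<open>\<bottom>\<close>. The list is indexed by all valuations; that only anchor points are
  ever stored is a property of the runs, not of the type.\<close>

type_synonym ('l, 'c) pw_list = "'l \<times> 'c valuation \<Rightarrow> (nat \<times> enat) option"
type_synonym ('l, 'c) call = "'l \<times> 'c valuation \<times> nat \<times> enat"

datatype ('l, 'c) config = Running "('l, 'c) pw_list" | Returned bool

fun add_to_pw :: "'l \<Rightarrow> ('l, 'c) call \<Rightarrow> ('l, 'c) pw_list \<Rightarrow> ('l, 'c) config" where
  "add_to_pw l\<^sub>g (l, \<alpha>, w, p) PW =
     (if l = l\<^sub>g then Returned True
      else case PW (l, \<alpha>) of
             None \<Rightarrow> Running (PW((l, \<alpha>) := Some (w, p)))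
           | Some (w', p') \<Rightarrow> Running (PW((l, \<alpha>) := Some (min w w', min p p'))))"

fun run_calls :: "'l \<Rightarrow> ('l, 'c) call list \<Rightarrow> ('l, 'c) pw_list \<Rightarrow> ('l, 'c) config" where
  "run_calls l\<^sub>g [] PW = Running PW"
| "run_calls l\<^sub>g (c # cs) PW =
     (case add_to_pw l\<^sub>g c PW of
        Running PW' \<Rightarrow> run_calls l\<^sub>g cs PW'
      | Returned b \<Rightarrow> Returned b)"

definition dart_start :: "'c::finite guard \<Rightarrow> 'c valuation \<Rightarrow> nat \<Rightarrow> nat" where
  "dart_start g \<alpha> w = nat (max (int w) (MAX x. int (lb (g x)) - int (\<alpha> x)))"

text \<open>The end point can be negative, in which case the edge is never enabled; hence neither the
  differences nor the result may be truncated at \<open>0\<close>.\<close>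

definition dart_end :: "'c::finite guard \<Rightarrow> 'c valuation \<Rightarrow> ereal" where
  "dart_end g \<alpha> = (MIN x. ereal_of_enat (ub (g x)) - ereal (real (\<alpha> x)))"

text \<open>Here truncated subtraction is harmless because of the maximum with \<open>start\<close>.\<close>

definition dart_stop :: "nat \<Rightarrow> 'c::finite set \<Rightarrow> 'c valuation \<Rightarrow> nat \<Rightarrow> nat" where
  "dart_stop MC R \<alpha> start =
     (if R = UNIV then start else max start (MC + 1 - (MIN x\<in>-R. \<alpha> x)))"

text \<open>The calls made for one edge, in order. The arguments depend only on the values of \<open>\<alpha>\<close>, \<open>w\<close> and
  \<open>p\<close> read when the dart was picked, not on later changes of the list. In the case without
  resets, the natural-number difference is never truncated in a run, since \<open>start \<le> MC\<close> there.
  In the other case the bound on \<open>n\<close> is at most \<open>stop\<close>, so that filtering \<open>start, \<dots>, stop\<close>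
  gives the range of the loop.\<close>

fun edge_calls ::
  "nat \<Rightarrow> 'c::finite valuation \<Rightarrow> nat \<Rightarrow> enat \<Rightarrow> ('l, 'c) edge \<Rightarrow> ('l, 'c) call list" where
  "edge_calls MC \<alpha> w p (l, g, R, l') =
     (let start = dart_start g \<alpha> w; end' = dart_end g \<alpha> in
      if enat start < p \<and> ereal (real start) \<le> end' then
        if R = {} then [(l', \<lambda>x. bounded_delay MC \<alpha> start x - start, start, \<infinity>)]
        else
          let stop = dart_stop MC R \<alpha> start in
          [(l', reset (bounded_delay MC \<alpha> n) R, 0, \<infinity>).
             n \<leftarrow> [start..<Suc stop],
             ereal (real n) \<le> min end' (min (ereal_of_enat p - 1) (ereal (real stop)))]
      else [])"

text \<open>One step is one iteration of the while-loop, or its exit. The nondeterminism is the choice of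
  the dart and of the order \<open>es\<close> in which the outgoing edges are processed.\<close>

inductive alg_step ::
  "('l::finite, 'c::finite) ta \<Rightarrow> 'l \<Rightarrow> ('l, 'c) config \<Rightarrow> ('l, 'c) config \<Rightarrow> bool"
  for A l\<^sub>g where
  iterate: "PW (l, \<alpha>) = Some (w, p) \<Longrightarrow> enat w < p \<Longrightarrow>
     distinct es \<Longrightarrow> set es = {e \<in> edges A. fst e = l} \<Longrightarrow>
     alg_step A l\<^sub>g (Running PW)
       (run_calls l\<^sub>g (concat (map (edge_calls (max_const A) \<alpha> w p) es))
          (PW((l, \<alpha>) := Some (w, enat w))))"
| exit: "(\<nexists>l \<alpha> w p. PW (l, \<alpha>) = Some (w, p) \<and> enat w < p) \<Longrightarrow>
     alg_step A l\<^sub>g (Running PW) (Returned False)"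

definition alg_init :: "('l, 'c) ta \<Rightarrow> 'l \<Rightarrow> ('l, 'c) config" where
  "alg_init A l\<^sub>g = add_to_pw l\<^sub>g (init_loc A, \<lambda>_. 0, 0, \<infinity>) (\<lambda>_. None)"

definition alg_reaches :: "('l::finite, 'c::finite) ta \<Rightarrow> 'l \<Rightarrow> ('l, 'c) config \<Rightarrow> bool" where
  "alg_reaches A l\<^sub>g s \<longleftrightarrow> (alg_step A l\<^sub>g)\<^sup>*\<^sup>* (alg_init A l\<^sub>g) s"

definition alg_terminates :: "('l::finite, 'c::finite) ta \<Rightarrow> 'l \<Rightarrow> bool" where
  "alg_terminates A l\<^sub>g \<longleftrightarrow>
     (\<nexists>\<rho>. \<rho> 0 = alg_init A l\<^sub>g \<and> (\<forall>i::nat. alg_step A l\<^sub>g (\<rho> i) (\<rho> (Suc i))))"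

definition alg_final :: "('l::finite, 'c::finite) ta \<Rightarrow> 'l \<Rightarrow> ('l, 'c) config \<Rightarrow> bool" where
  "alg_final A l\<^sub>g s \<longleftrightarrow> (\<nexists>s'. alg_step A l\<^sub>g s s')"

end

theory Submission
  imports Defs
begin

text \<open>Valuations are compared up to the equivalence that identifies all clock values above the maximal
  constant; it is a bisimulation. Every entry \<open>(w, p)\<close> stored at \<open>(l, \<alpha>)\<close> stands for the states
  \<open>\<alpha> + n\<close> with \<open>n \<ge> w\<close>, each equivalent to a reachable one (soundness), and the discrete successors
  of those with \<open>n \<ge> p\<close> are already represented (completeness). When no entry has \<open>w < p\<close>, the
  represented states are closed under all transitions. Termination holds because the entries only
  decrease, are capped by the maximal constant, and only finitely many anchor points occur.\<close>

section \<open>Equivalence of valuations up to a cap\<close>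

text \<open>Used with \<open>K = MC + 1\<close>. Capping at \<open>MC\<close> would identify
  \<open>MC\<close> with \<open>MC + 1\<close>, which a guard with upper bound \<open>MC\<close>
  tells apart.\<close>

definition cap_eq :: "nat \<Rightarrow> 'c valuation \<Rightarrow> 'c valuation \<Rightarrow> bool" where
  "cap_eq K u v \<longleftrightarrow> (\<forall>x. min (u x) K = min (v x) K)"

lemma cap_eq_refl: "cap_eq K u u"
  by (simp add: cap_eq_def)

lemma cap_eq_sym: "cap_eq K u v \<Longrightarrow> cap_eq K v u"
  by (simp add: cap_eq_def)

lemma cap_eq_trans: "cap_eq K u v \<Longrightarrow> cap_eq K v w \<Longrightarrow> cap_eq K u w"
  by (simp add: cap_eq_def)

lemma cap_eq_delay:
  assumes "cap_eq K u v"
  shows "cap_eq K (delay u d) (delay v d)"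
  unfolding cap_eq_def delay_def
proof
  fix x
  have "min (u x) K = min (v x) K"
    using assms by (simp add: cap_eq_def)
  then show "min (u x + d) K = min (v x + d) K"
    by linarith
qed

lemma cap_eq_reset: "cap_eq K u v \<Longrightarrow> cap_eq K (reset u R) (reset v R)"
  by (simp add: cap_eq_def reset_def)

lemma delay_delay: "delay (delay v a) b = delay v (a + b)"
  by (simp add: delay_def add.assoc)

lemma reset_empty: "reset v {} = v"
  by (simp add: reset_def)

lemma cap_eq_bounded_delay: "cap_eq (Suc MC) (bounded_delay MC \<alpha> n) (delay \<alpha> n)"
  by (auto simp: cap_eq_def bounded_delay_def bounded_add_def delay_def)

lemma bounded_delay_le: "bounded_delay MC \<alpha> n x \<le> Suc MC"
  by (simp add: bounded_delay_def bounded_add_def)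

text \<open>Each clock of the bounded sum is \<open>\<alpha> x + n\<close> or \<open>MC + 1\<close>,
  hence at least \<open>n\<close>, so the subtraction is not truncated.\<close>

lemma delay_bounded_delay_diff:
  assumes "n \<le> Suc MC"
  shows "delay (\<lambda>x. bounded_delay MC \<alpha> n x - n) n = bounded_delay MC \<alpha> n"
  using assms by (auto simp: delay_def bounded_delay_def bounded_add_def)

section \<open>Guards and the maximal constant\<close>

lemma finite_guard_constants:
  fixes A :: "('l::finite, 'c::finite) ta"
  assumes "timed_automaton A"
  shows "finite (guard_constants A)"
proof -
  have "finite (edges A)"
    using assms by (simp add: timed_automaton_def)
  \<comment> \<open>An infinite upper bound contributes an unspecified value of
    \<open>the_enat\<close>, so this set only includes the constants.\<close>
  then have "finite (\<Union>(l, g, R, l') \<in> edges A.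
    (\<lambda>x. lb (g x)) ` UNIV \<union> (\<lambda>x. the_enat (ub (g x))) ` UNIV)"
    by auto
  then show ?thesis
  proof (rule rev_finite_subset, intro subsetI)
    fix n
    assume "n \<in> guard_constants A"
    then obtain l g R l' x where "(l, g, R, l') \<in> edges A" "n = lb (g x) \<or> enat n = ub (g x)"
      unfolding guard_constants_def by blast
    moreover have "the_enat (ub (g x)) = n" if "enat n = ub (g x)"
      using that by (metis the_enat.simps)
    ultimately show "n \<in> (\<Union>(l, g, R, l') \<in> edges A.
        (\<lambda>x. lb (g x)) ` UNIV \<union> (\<lambda>x. the_enat (ub (g x))) ` UNIV)"
      by blast
  qed
qed

lemma max_const_ge:
  fixes A :: "('l::finite, 'c::finite) ta"
  assumes "timed_automaton A" "(l, g, R, l') \<in> edges A"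
  shows "lb (g x) \<le> max_const A" "ub (g x) = enat b \<Longrightarrow> b \<le> max_const A"
proof -
  have "n \<le> max_const A" if "n \<in> guard_constants A" for n
    using finite_guard_constants[OF assms(1)] that by (simp add: max_const_def)
  moreover have "lb (g x) \<in> guard_constants A"
    "ub (g x) = enat b \<Longrightarrow> b \<in> guard_constants A"
    using assms(2) unfolding guard_constants_def by (metis (mono_tags, lifting) case_prodI mem_Collect_eq)+
  ultimately show "lb (g x) \<le> max_const A" "ub (g x) = enat b \<Longrightarrow> b \<le> max_const A"
    by blast+
qed

text \<open>Guards compare clocks only with constants up to \<open>MC\<close>, and the value capped
  at \<open>MC + 1\<close> decides every such comparison.\<close>

lemma sat_cap_eq:
  fixes A :: "('l::finite, 'c::finite) ta"
  assumes A: "timed_automaton A" "(l, g, R, l') \<in> edges A"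
    and eq: "cap_eq (Suc (max_const A)) u v" and "sat u g"
  shows "sat v g"
  unfolding sat_def
proof
  fix x
  have 1: "min (u x) (Suc (max_const A)) = min (v x) (Suc (max_const A))"
    using eq by (simp add: cap_eq_def)
  have 2: "lb (g x) \<le> u x" "enat (u x) \<le> ub (g x)"
    using \<open>sat u g\<close> by (auto simp: sat_def points_def)
  have "lb (g x) \<le> v x"
    using 1 2 max_const_ge(1)[OF A, of x] by linarith
  moreover have "enat (v x) \<le> ub (g x)"
  proof (cases "ub (g x)")
    case (enat b)
    then show ?thesis
      using 1 2 max_const_ge(2)[OF A, of x b] by simp
  qed simp
  ultimately show "v x \<in> points (g x)"
    by (simp add: points_def)
qed

section \<open>The calls made for one edge\<close>

text \<open>The conversion by \<open>nat\<close> loses nothing, since the maximum with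
  \<open>w\<close> is nonnegative.\<close>

lemma dart_start_le_iff:
  "dart_start g \<alpha> w \<le> n \<longleftrightarrow> w \<le> n \<and> (\<forall>x. lb (g x) \<le> \<alpha> x + n)"
proof -
  have "dart_start g \<alpha> w \<le> n \<longleftrightarrow>
      w \<le> n \<and> (MAX x. int (lb (g x)) - int (\<alpha> x)) \<le> int n"
    by (simp add: dart_start_def nat_le_iff)
  also have "(MAX x. int (lb (g x)) - int (\<alpha> x)) \<le> int n \<longleftrightarrow> (\<forall>x. lb (g x) \<le> \<alpha> x + n)"
    by (subst Max_le_iff) (auto simp: algebra_simps zle_int[symmetric] simp del: zle_int)
  finally show ?thesis .
qed

text \<open>Extended reals keep negative differences, and an infinite upper bound stays
  infinite.\<close>

lemma le_dart_end_iff: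
  "ereal (real n) \<le> dart_end g \<alpha> \<longleftrightarrow> (\<forall>x. enat (\<alpha> x + n) \<le> ub (g x))"
proof -
  have "ereal (real n) \<le> ereal_of_enat u - ereal (real a) \<longleftrightarrow> enat (a + n) \<le> u" for u a
    by (cases u) auto
  then show ?thesis
    unfolding dart_end_def by (subst Min_ge_iff) auto
qed

lemma sat_delay_iff:
  "w \<le> n \<and> sat (delay \<alpha> n) g \<longleftrightarrow>
    dart_start g \<alpha> w \<le> n \<and> ereal (real n) \<le> dart_end g \<alpha>"
  by (auto simp: dart_start_le_iff le_dart_end_iff sat_def points_def delay_def)

text \<open>For \<open>p = 0\<close> the bound is -1 and excludes every \<open>n\<close>; a
  truncated subtraction would admit \<open>n = 0\<close>.\<close>

lemma le_ereal_of_enat_minus_one_iff: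
  "ereal (real n) \<le> ereal_of_enat p - 1 \<longleftrightarrow> enat n < p"
  by (cases p) (auto simp: one_ereal_def)

text \<open>Membership suffices, because the facts proved below about \<open>run_calls\<close>
  mention only the set of calls.\<close>

lemma edge_calls_iff:
  "c \<in> set (edge_calls MC \<alpha> w p (l, g, R, l')) \<longleftrightarrow>
    (let s = dart_start g \<alpha> w in enat s < p \<and> ereal (real s) \<le> dart_end g \<alpha> \<and>
      (if R = {} then c = (l', \<lambda>x. bounded_delay MC \<alpha> s x - s, s, \<infinity>)
       else \<exists>n. s \<le> n \<and> n \<le> dart_stop MC R \<alpha> s \<and> enat n < p \<and> ereal (real n) \<le> dart_end g \<alpha> \<and>
         c = (l', reset (bounded_delay MC \<alpha> n) R, 0, \<infinity>)))"
  by (auto simp: Let_def le_ereal_of_enat_minus_one_iff simp del: upt_Suc)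

section \<open>Reachable states and correctness of the calls of one edge\<close>

definition ds_state :: "('l, 'c) ta \<Rightarrow> 'l \<Rightarrow> 'c valuation \<Rightarrow> bool" where
  "ds_state A l v \<longleftrightarrow> (\<lambda>s s'. \<exists>a. ds_trans A s a s')\<^sup>*\<^sup>* (init_loc A, \<lambda>_. 0) (l, v)"

lemma ds_reachable_iff: "ds_reachable A l \<longleftrightarrow> (\<exists>v. ds_state A l v)"
  by (simp add: ds_reachable_def ds_state_def)

lemma ds_state_init: "ds_state A (init_loc A) (\<lambda>_. 0)"
  by (simp add: ds_state_def)

lemma ds_state_delay: "ds_state A l v \<Longrightarrow> ds_state A l (delay v d)"
  unfolding ds_state_def by (erule rtranclp.rtrancl_into_rtrancl) (auto intro: ds_trans.del)

lemma ds_state_tau: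
  "ds_state A l v \<Longrightarrow> (l, g, R, l') \<in> edges A \<Longrightarrow> sat v g \<Longrightarrow> ds_state A l' (reset v R)"
  unfolding ds_state_def by (erule rtranclp.rtrancl_into_rtrancl) (auto intro: ds_trans.tau)

text \<open>One reachable witness at delay \<open>w\<close> is enough, since waiting yields the
  later points of the dart. The bound on \<open>\<alpha>\<close> leaves finitely many anchor points,
  and the bound on \<open>w\<close> keeps start points within \<open>MC\<close> and makes each pick
  lower the termination measure.\<close>

definition sound_dart :: "('l, 'c) ta \<Rightarrow> 'l \<Rightarrow> 'c valuation \<Rightarrow> nat \<Rightarrow> bool" where
  "sound_dart A l \<alpha> w \<longleftrightarrow> \<alpha> \<in> anchor_points \<and> (\<forall>x. \<alpha> x \<le> Suc (max_const A)) \<and> w \<le> max_const A \<and>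
     (\<exists>v. ds_state A l v \<and> cap_eq (Suc (max_const A)) v (delay \<alpha> w))"

text \<open>For a call at delay \<open>n\<close>, the reachable witness waits \<open>n - w\<close>
  and takes the edge; the guard transfers along the equivalence. The infinite \<open>q\<close> later
  shows that a finite upper bound never originates from a call.\<close>

lemma edge_calls_sound:
  fixes A :: "('l::finite, 'c::finite) ta"
  assumes A: "timed_automaton A" and e: "(l, g, R, l') \<in> edges A"
    and dart: "sound_dart A l \<alpha> w"
    and call: "(k, \<beta>, u, q) \<in> set (edge_calls (max_const A) \<alpha> w p (l, g, R, l'))"
  shows "sound_dart A k \<beta> u \<and> q = \<infinity>"
proof -
  define MC where "MC = max_const A"
  define s where "s = dart_start g \<alpha> w"
  have wMC: "w \<le> MC" and anchor: "\<alpha> \<in> anchor_points"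
    using dart by (auto simp: sound_dart_def MC_def)
  obtain v where v: "ds_state A l v" "cap_eq (Suc MC) v (delay \<alpha> w)"
    using dart by (auto simp: sound_dart_def MC_def)
  have sMC: "s \<le> MC"
    using max_const_ge(1)[OF A e] wMC
    by (auto simp: s_def dart_start_le_iff MC_def intro: trans_le_add2)
  \<comment> \<open>Serves both cases: \<open>n = s\<close> for an edge without resets, any
    \<open>n\<close> of the loop otherwise.\<close>
  have step: "\<exists>v'. ds_state A l' v' \<and> cap_eq (Suc MC) v' (reset (bounded_delay MC \<alpha> n) R)"
    if n: "s \<le> n" "ereal (real n) \<le> dart_end g \<alpha>" for n
  proof -
    have wn: "w \<le> n" and satn: "sat (delay \<alpha> n) g"
      using n sat_delay_iff[of w n \<alpha> g] by (auto simp: s_def)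
    define v' where "v' = delay v (n - w)"
    have eq: "cap_eq (Suc MC) v' (delay \<alpha> n)"
      using cap_eq_delay[OF v(2), of "n - w"] wn by (simp add: v'_def delay_delay)
    have "sat v' g"
      using sat_cap_eq[OF A e _ satn] cap_eq_sym[OF eq] by (simp add: MC_def)
    then have "ds_state A l' (reset v' R)"
      using ds_state_tau[OF ds_state_delay[OF v(1)] e] by (simp add: v'_def)
    moreover have "cap_eq (Suc MC) (reset v' R) (reset (bounded_delay MC \<alpha> n) R)"
      by (intro cap_eq_reset cap_eq_trans[OF eq] cap_eq_sym[OF cap_eq_bounded_delay])
    ultimately show ?thesis
      by blast
  qed
  have s_end: "ereal (real s) \<le> dart_end g \<alpha>"
    using call by (auto simp: edge_calls_iff Let_def s_def)
  show ?thesis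
  proof (cases "R = {}")
    case True
    then have c: "k = l'" "\<beta> = (\<lambda>x. bounded_delay MC \<alpha> s x - s)" "u = s" "q = \<infinity>"
      using call by (auto simp: edge_calls_iff Let_def s_def MC_def)
    \<comment> \<open>As \<open>s \<le> MC\<close>, this clock equals \<open>s\<close> after the
      bounded delay, so subtracting \<open>s\<close> brings it back to 0 and \<open>\<beta>\<close>
      is an anchor point.\<close>
    obtain x where "\<alpha> x = 0"
      using anchor by (auto simp: anchor_points_def)
    then have "\<beta> x = 0"
      using sMC by (simp add: c bounded_delay_def bounded_add_def)
    moreover have "\<beta> x \<le> Suc MC" for x
      using bounded_delay_le[of MC \<alpha> s x] by (simp add: c)
    moreover have "delay \<beta> s = bounded_delay MC \<alpha> s"
      using delay_bounded_delay_diff[of s MC \<alpha>] sMC by (simp add: c)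
    ultimately show ?thesis
      using step[OF order_refl s_end] sMC c True
      by (auto simp: sound_dart_def anchor_points_def MC_def reset_empty)
  next
    case False
    then obtain n where n: "s \<le> n" "ereal (real n) \<le> dart_end g \<alpha>"
      and c: "k = l'" "\<beta> = reset (bounded_delay MC \<alpha> n) R" "u = 0" "q = \<infinity>"
      using call by (auto simp: edge_calls_iff Let_def s_def MC_def)
    have "\<beta> \<in> anchor_points"
      using False by (auto simp: c reset_def anchor_points_def)
    moreover have "\<beta> x \<le> Suc MC" for x
      using bounded_delay_le[of MC \<alpha> n x] by (simp add: c reset_def)
    moreover have "delay \<beta> 0 = \<beta>"
      by (simp add: delay_def)
    ultimately show ?thesis
      using step[OF n] c by (auto simp: sound_dart_def MC_def)
  qed
qed

text \<open>From the stop point on, every clock outside \<open>R\<close> exceeds \<open>MC\<close>,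
  so waiting longer before the reset stays in the same class.\<close>

lemma cap_eq_reset_beyond_stop:
  assumes "dart_stop MC R \<alpha> s \<le> m" "m \<le> n"
  shows "cap_eq (Suc MC) (reset (delay \<alpha> n) R) (reset (delay \<alpha> m) R)"
  unfolding cap_eq_def
proof
  fix x
  show "min (reset (delay \<alpha> n) R x) (Suc MC) = min (reset (delay \<alpha> m) R x) (Suc MC)"
  proof (cases "x \<in> R")
    case False
    then have "R \<noteq> UNIV" and "(MIN x\<in>-R. \<alpha> x) \<le> \<alpha> x"
      by auto
    then have "Suc MC \<le> \<alpha> x + m"
      using assms(1) by (simp add: dart_stop_def) linarith
    then show ?thesis
      using assms(2) by (simp add: reset_def delay_def)
  qed (simp add: reset_def)
qed

text \<open>Without resets, the single new dart starts at the start point and passes through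
  \<open>m = n\<close>. With resets, the loop contains \<open>n\<close> or, if \<open>n\<close> lies
  beyond the stop point, the equivalent stop point; the new dart is then met at
  \<open>m = 0\<close>.\<close>

lemma edge_calls_complete:
  assumes n: "w \<le> n" "enat n < p" and sat: "sat (delay \<alpha> n) g"
    and sMC: "dart_start g \<alpha> w \<le> MC"
  shows "\<exists>\<beta> u q m. (l', \<beta>, u, q) \<in> set (edge_calls MC \<alpha> w p (l, g, R, l')) \<and> u \<le> m \<and>
    cap_eq (Suc MC) (reset (delay \<alpha> n) R) (delay \<beta> m)"
proof -
  define s where "s = dart_start g \<alpha> w"
  have sn: "s \<le> n" and n_end: "ereal (real n) \<le> dart_end g \<alpha>"
    using n sat sat_delay_iff[of w n \<alpha> g] by (auto simp: s_def)
  \<comment> \<open>Both conditions pass to smaller delays, so they hold at \<open>s\<close> and at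
    the \<open>m\<close> chosen in the reset case.\<close>
  have before: "enat m < p \<and> ereal (real m) \<le> dart_end g \<alpha>" if "m \<le> n" for m
  proof
    show "enat m < p"
      using that n(2) by (meson enat_ord_simps(1) order.strict_trans1)
    have "ereal (real m) \<le> ereal (real n)"
      using that by simp
    then show "ereal (real m) \<le> dart_end g \<alpha>"
      using n_end order_trans by blast
  qed
  show ?thesis
  proof (cases "R = {}")
    case True
    let ?\<beta> = "\<lambda>x. bounded_delay MC \<alpha> s x - s"
    have "cap_eq (Suc MC) (delay \<alpha> s) (delay ?\<beta> s)"
      using sMC cap_eq_sym[OF cap_eq_bounded_delay[of MC \<alpha> s]]
      by (simp add: delay_bounded_delay_diff s_def)
    from cap_eq_delay[OF this, of "n - s"]
    have "cap_eq (Suc MC) (delay \<alpha> n) (delay ?\<beta> n)"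
      using sn by (simp add: delay_delay)
    moreover have "(l', ?\<beta>, s, \<infinity>) \<in> set (edge_calls MC \<alpha> w p (l, g, R, l'))"
      using before[OF sn] True unfolding edge_calls_iff by (simp add: Let_def s_def)
    ultimately show ?thesis
      using sn True by (auto simp: reset_empty)
  next
    case False
    define stop where "stop = dart_stop MC R \<alpha> s"
    define m where "m = min n stop"
    have "s \<le> stop"
      by (simp add: stop_def dart_stop_def)
    then have m: "s \<le> m" "m \<le> n" "m \<le> stop"
      using sn by (auto simp: m_def)
    let ?\<beta> = "reset (bounded_delay MC \<alpha> m) R"
    have call: "(l', ?\<beta>, 0, \<infinity>) \<in> set (edge_calls MC \<alpha> w p (l, g, R, l'))"
      using before[OF sn] before[OF m(2)] m False unfolding edge_calls_iff
      by (auto simp: Let_def s_def stop_def)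
    have "cap_eq (Suc MC) (reset (delay \<alpha> n) R) (reset (delay \<alpha> m) R)"
    proof (cases "n \<le> stop")
      case True
      then show ?thesis
        by (simp add: m_def cap_eq_refl)
    next
      case False
      then show ?thesis
        using cap_eq_reset_beyond_stop[of MC R \<alpha> s m n] by (simp add: m_def stop_def)
    qed
    then have "cap_eq (Suc MC) (reset (delay \<alpha> n) R) (delay ?\<beta> 0)"
      using cap_eq_trans[OF _ cap_eq_reset[OF cap_eq_sym[OF cap_eq_bounded_delay]]]
      by (simp add: delay_def)
    then show ?thesis
      using call by blast
  qed
qed

section \<open>Evolution of the passed-waiting list\<close>

text \<open>A missing entry counts as the largest one, so inserting an entry also goes down in this
  order.\<close>

definition pw_le :: "('l, 'c) pw_list \<Rightarrow> ('l, 'c) pw_list \<Rightarrow> bool" where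
  "pw_le PW' PW \<longleftrightarrow> (\<forall>k w p. PW k = Some (w, p) \<longrightarrow>
     (\<exists>w' p'. PW' k = Some (w', p') \<and> w' \<le> w \<and> p' \<le> p))"

lemma pw_le_refl: "pw_le PW PW"
  by (auto simp: pw_le_def)

lemma pw_le_trans: "pw_le PW'' PW' \<Longrightarrow> pw_le PW' PW \<Longrightarrow> pw_le PW'' PW"
  unfolding pw_le_def by (meson order_trans)

lemma add_to_pw_cases:
  obtains (found) "l = l\<^sub>g" "add_to_pw l\<^sub>g (l, \<alpha>, w, p) PW = Returned True"
  | (new) "l \<noteq> l\<^sub>g" "PW (l, \<alpha>) = None"
      "add_to_pw l\<^sub>g (l, \<alpha>, w, p) PW = Running (PW((l, \<alpha>) := Some (w, p)))"
  | (old) w' p' where "l \<noteq> l\<^sub>g" "PW (l, \<alpha>) = Some (w', p')"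
      "add_to_pw l\<^sub>g (l, \<alpha>, w, p) PW = Running (PW((l, \<alpha>) := Some (min w w', min p p')))"
  by (cases "l = l\<^sub>g"; cases "PW (l, \<alpha>)") auto

lemma run_calls_Returned:
  "run_calls l\<^sub>g cs PW = Returned b \<Longrightarrow> b \<and> (\<exists>\<alpha> w p. (l\<^sub>g, \<alpha>, w, p) \<in> set cs)"
proof (induction cs arbitrary: PW)
  case (Cons c cs)
  obtain l \<alpha> w p where "c = (l, \<alpha>, w, p)"
    by (metis prod_cases4)
  with Cons show ?case
    by (cases l\<^sub>g l \<alpha> w p PW rule: add_to_pw_cases) fastforce+
qed simp

text \<open>The origin of each entry is stated separately for its two components: minima are taken
  componentwise, so \<open>w\<close> and \<open>p\<close> may stem from different sources.\<close>

lemma run_calls_Running: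
  assumes "run_calls l\<^sub>g cs PW = Running PW'"
  shows "pw_le PW' PW \<and>
    (\<forall>(l, \<alpha>, w, p) \<in> set cs. l \<noteq> l\<^sub>g \<and> (\<exists>w' p'. PW' (l, \<alpha>) = Some (w', p') \<and> w' \<le> w \<and> p' \<le> p)) \<and>
    (\<forall>l \<alpha> w p. PW' (l, \<alpha>) = Some (w, p) \<longrightarrow>
      (\<exists>p. PW (l, \<alpha>) = Some (w, p) \<or> (l, \<alpha>, w, p) \<in> set cs) \<and>
      (\<exists>w. PW (l, \<alpha>) = Some (w, p) \<or> (l, \<alpha>, w, p) \<in> set cs))"
  using assms
proof (induction cs arbitrary: PW)
  case Nil
  then show ?case
    by (auto simp: pw_le_refl)
next
  case (Cons c cs)
  obtain l \<alpha> w p where c: "c = (l, \<alpha>, w, p)"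
    by (metis prod_cases4)
  \<comment> \<open>The entry left by the first call, uniformly for a new and a merged key. That
    call cannot hit the goal, as the run ends in \<open>Running\<close>.\<close>
  obtain w1 p1 where PW1: "l \<noteq> l\<^sub>g" "w1 \<le> w" "p1 \<le> p"
      "run_calls l\<^sub>g cs (PW((l, \<alpha>) := Some (w1, p1))) = Running PW'"
    and le: "pw_le (PW((l, \<alpha>) := Some (w1, p1))) PW"
    and w1: "w1 = w \<or> (\<exists>p. PW (l, \<alpha>) = Some (w1, p))"
    and p1: "p1 = p \<or> (\<exists>w. PW (l, \<alpha>) = Some (w, p1))"
  proof (cases l\<^sub>g l \<alpha> w p PW rule: add_to_pw_cases)
    case found
    then show ?thesis
      using Cons.prems c by simp
  next
    case new
    then show ?thesis
      using Cons.prems c by (intro that[of w p]) (auto simp: pw_le_def)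
  next
    case (old w' p')
    then show ?thesis
      using Cons.prems c
      by (intro that[of "min w w'" "min p p'"]) (auto simp: pw_le_def min_def)
  qed
  note IH = Cons.IH[OF PW1(4)]
  have 1: "pw_le PW' PW"
    using IH[THEN conjunct1] le by (rule pw_le_trans)
  obtain w' p' where "PW' (l, \<alpha>) = Some (w', p')" "w' \<le> w1" "p' \<le> p1"
    using IH[THEN conjunct1] unfolding pw_le_def by (metis fun_upd_same)
  then have 2: "\<exists>w' p'. PW' (l, \<alpha>) = Some (w', p') \<and> w' \<le> w \<and> p' \<le> p"
    using PW1(2,3) by (metis order_trans)
  have 3: "(\<exists>q. PW (k, \<beta>) = Some (u, q) \<or> (k, \<beta>, u, q) \<in> set (c # cs)) \<and>
      (\<exists>u. PW (k, \<beta>) = Some (u, q) \<or> (k, \<beta>, u, q) \<in> set (c # cs))"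
    if "PW' (k, \<beta>) = Some (u, q)" for k \<beta> u q
  proof -
    note kb = IH[THEN conjunct2, THEN conjunct2, rule_format, OF that]
    show ?thesis
    proof (cases "(k, \<beta>) = (l, \<alpha>)")
      case True
      then have "u = w1 \<or> (\<exists>q. (l, \<alpha>, u, q) \<in> set cs)" "q = p1 \<or> (\<exists>u. (l, \<alpha>, u, q) \<in> set cs)"
        using kb by auto
      then show ?thesis
        using True w1 p1 by (auto simp: c)
    next
      case False
      then have "(PW((l, \<alpha>) := Some (w1, p1))) (k, \<beta>) = PW (k, \<beta>)"
        by auto
      then show ?thesis
        using kb by auto
    qed
  qed
  have 4: "\<forall>(k, \<beta>, u, q) \<in> set (c # cs).
      k \<noteq> l\<^sub>g \<and> (\<exists>w' p'. PW' (k, \<beta>) = Some (w', p') \<and> w' \<le> u \<and> p' \<le> q)"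
    using IH[THEN conjunct2, THEN conjunct1] 2 PW1(1) by (simp add: c)
  show ?case
    by (intro conjI[OF 1 conjI[OF 4]] allI impI) (rule 3)
qed

section \<open>Soundness and completeness\<close>

text \<open>Waiting and explored parts of a dart count alike: a successor has to be represented, not
  yet processed.\<close>

definition covered :: "nat \<Rightarrow> ('l, 'c) pw_list \<Rightarrow> 'l \<Rightarrow> 'c valuation \<Rightarrow> bool" where
  "covered MC PW l v \<longleftrightarrow>
     (\<exists>\<alpha> w p n. PW (l, \<alpha>) = Some (w, p) \<and> w \<le> n \<and> cap_eq (Suc MC) v (delay \<alpha> n))"

lemma covered_mono:
  assumes "pw_le PW' PW" "covered MC PW l v"
  shows "covered MC PW' l v"
proof -
  obtain \<alpha> w p n where v: "PW (l, \<alpha>) = Some (w, p)" "w \<le> n" "cap_eq (Suc MC) v (delay \<alpha> n)"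
    using assms(2) by (auto simp: covered_def)
  then obtain w' p' where "PW' (l, \<alpha>) = Some (w', p')" "w' \<le> w"
    using assms(1) unfolding pw_le_def by blast
  moreover have "w' \<le> n"
    using \<open>w' \<le> w\<close> \<open>w \<le> n\<close> by simp
  ultimately show ?thesis
    using v(3) unfolding covered_def by blast
qed

lemma covered_cap_eq: "cap_eq (Suc MC) u v \<Longrightarrow> covered MC PW l v \<Longrightarrow> covered MC PW l u"
  unfolding covered_def using cap_eq_trans by blast

section \<open>The loop invariant\<close>

definition pw_sound :: "('l, 'c) ta \<Rightarrow> 'l \<Rightarrow> ('l, 'c) pw_list \<Rightarrow> bool" where
  "pw_sound A l\<^sub>g PW \<longleftrightarrow>
     (\<forall>l \<alpha> w p. PW (l, \<alpha>) = Some (w, p) \<longrightarrow> l \<noteq> l\<^sub>g \<and> sound_dart A l \<alpha> w)"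

text \<open>Here \<open>p\<close> is the exploration frontier: a fresh dart with
  \<open>p = \<infinity>\<close> carries no obligation, and lowering \<open>p\<close> to
  \<open>w\<close> adds obligations for \<open>w \<le> n < p\<close>.\<close>

definition pw_complete :: "('l, 'c) ta \<Rightarrow> ('l, 'c) pw_list \<Rightarrow> bool" where
  "pw_complete A PW \<longleftrightarrow>
     covered (max_const A) PW (init_loc A) (\<lambda>_. 0) \<and>
     (\<forall>l \<alpha> w p n g R l'. PW (l, \<alpha>) = Some (w, p) \<longrightarrow> p \<le> enat n \<longrightarrow>
        (l, g, R, l') \<in> edges A \<longrightarrow> sat (delay \<alpha> n) g \<longrightarrow>
        covered (max_const A) PW l' (reset (delay \<alpha> n) R))"

fun config_inv :: "('l, 'c) ta \<Rightarrow> 'l \<Rightarrow> ('l, 'c) config \<Rightarrow> bool" where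
  "config_inv A l\<^sub>g (Running PW) \<longleftrightarrow> pw_sound A l\<^sub>g PW \<and> pw_complete A PW"
| "config_inv A l\<^sub>g (Returned b) \<longleftrightarrow> b = ds_reachable A l\<^sub>g"

lemma config_inv_init:
  fixes A :: "('l, 'c) ta"
  shows "config_inv A l\<^sub>g (alg_init A l\<^sub>g)"
proof (cases "init_loc A = l\<^sub>g")
  case True
  then show ?thesis
    using ds_state_init[of A] by (auto simp: alg_init_def ds_reachable_iff)
next
  case False
  have "sound_dart A (init_loc A) (\<lambda>_. 0) 0"
    using ds_state_init[of A]
    by (auto simp: sound_dart_def anchor_points_def delay_def cap_eq_def)
  note dart = this
  define PW :: "('l, 'c) pw_list"
    where "PW = (\<lambda>_. None)((init_loc A, \<lambda>_. 0) := Some (0, \<infinity>))"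
  have PW: "l = init_loc A \<and> \<alpha> = (\<lambda>_. 0) \<and> w = 0 \<and> p = \<infinity>"
    if "PW (l, \<alpha>) = Some (w, p)" for l \<alpha> w p
    using that by (simp add: PW_def split: if_splits)
  have "pw_sound A l\<^sub>g PW"
    unfolding pw_sound_def using PW dart False by metis
  moreover have "pw_complete A PW"
    unfolding pw_complete_def
  proof (intro conjI allI impI)
    have "PW (init_loc A, \<lambda>_. 0) = Some (0, \<infinity>)"
      by (simp add: PW_def)
    moreover have "cap_eq (Suc (max_const A)) (\<lambda>_. 0) (delay (\<lambda>_. 0) 0)"
      by (simp add: delay_def cap_eq_refl)
    ultimately show "covered (max_const A) PW (init_loc A) (\<lambda>_. 0)"
      unfolding covered_def by blast
  next
    fix l \<alpha> w p n g R l'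
    assume "PW (l, \<alpha>) = Some (w, p)" "p \<le> enat n"
    then show "covered (max_const A) PW l' (reset (delay \<alpha> n) R)"
      using PW[of l \<alpha> w p] by simp
  qed
  ultimately show ?thesis
    using False by (simp add: alg_init_def PW_def)
qed

text \<open>Induction along the run: a delay moves along the same dart, and an edge leaves from a
  point beyond the frontier.\<close>

lemma covered_if_ds_state:
  fixes A :: "('l::finite, 'c::finite) ta"
  assumes A: "timed_automaton A" and complete: "pw_complete A PW"
    and no_waiting: "\<nexists>l \<alpha> w p. PW (l, \<alpha>) = Some (w, p) \<and> enat w < p"
    and "ds_state A l v"
  shows "covered (max_const A) PW l v"
  using \<open>ds_state A l v\<close>[unfolded ds_state_def]
proof (induction "(l, v)" arbitrary: l v rule: rtranclp_induct)
  case base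
  then show ?case
    using complete by (simp add: pw_complete_def)
next
  case (step s)
  obtain k u where s: "s = (k, u)"
    by (cases s)
  obtain \<alpha> w p n where PW: "PW (k, \<alpha>) = Some (w, p)" "w \<le> n"
    and eq: "cap_eq (Suc (max_const A)) u (delay \<alpha> n)"
    using step.hyps(3)[OF s] by (auto simp: covered_def)
  from step.hyps(2) obtain a where "ds_trans A (k, u) a (l, v)"
    using s by blast
  then show ?case
  proof cases
    case (tau g R)
    \<comment> \<open>Nothing is waiting, so \<open>p \<le> w \<le> n\<close> and completeness
      applies at \<open>n\<close>.\<close>
    have "\<not> enat w < p"
      using PW(1) no_waiting by blast
    then have pn: "p \<le> enat n"
      using PW(2) by (cases p) auto
    have satn: "sat (delay \<alpha> n) g"
      using sat_cap_eq[OF A tau(3) eq tau(4)] .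
    have "covered (max_const A) PW l (reset (delay \<alpha> n) R)"
      using complete[unfolded pw_complete_def, THEN conjunct2, rule_format, OF PW(1) pn tau(3) satn] .
    then show ?thesis
      using covered_cap_eq[OF cap_eq_reset[OF eq]] tau(2) by simp
  next
    case (del d)
    moreover have "cap_eq (Suc (max_const A)) (delay u d) (delay \<alpha> (n + d))"
      using cap_eq_delay[OF eq, of d] by (simp add: delay_delay)
    moreover have "w \<le> n + d"
      using PW(2) by simp
    ultimately show ?thesis
      using PW(1) unfolding covered_def by blast
  qed
qed

text \<open>Only the picked dart gains obligations, at \<open>w \<le> n < p\<close>, and the calls
  just made discharge them. Older obligations persist because coverage is monotone; soundness
  follows from the origin of each lower bound.\<close>

lemma config_inv_iterate:
  fixes A :: "('l::finite, 'c::finite) ta"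
  assumes A: "timed_automaton A" and inv: "config_inv A l\<^sub>g (Running PW)"
    and PW: "PW (l, \<alpha>) = Some (w, p)" "enat w < p"
    and es: "set es = {e \<in> edges A. fst e = l}"
  shows "config_inv A l\<^sub>g (run_calls l\<^sub>g (concat (map (edge_calls (max_const A) \<alpha> w p) es))
    (PW((l, \<alpha>) := Some (w, enat w))))"
    (is "config_inv A l\<^sub>g (run_calls l\<^sub>g ?cs ?PW1)")
proof -
  have sound: "pw_sound A l\<^sub>g PW" and complete: "pw_complete A PW"
    using inv by simp_all
  have dart: "sound_dart A l \<alpha> w"
    using sound PW unfolding pw_sound_def by blast
  have calls: "sound_dart A k \<beta> u \<and> q = \<infinity>" if c: "(k, \<beta>, u, q) \<in> set ?cs" for k \<beta> u q
  proof -
    obtain e where e: "e \<in> edges A" "fst e = l"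
      and c': "(k, \<beta>, u, q) \<in> set (edge_calls (max_const A) \<alpha> w p e)"
      using c es by auto
    obtain g R l' where e': "e = (l, g, R, l')"
      using e(2) by (cases e) auto
    show ?thesis
      using edge_calls_sound[OF A e(1)[unfolded e'] dart c'[unfolded e']] .
  qed
  show ?thesis
  proof (cases "run_calls l\<^sub>g ?cs ?PW1")
    case (Returned b)
    then obtain \<beta> u q where "b" and c: "(l\<^sub>g, \<beta>, u, q) \<in> set ?cs"
      using run_calls_Returned[OF Returned] by blast
    have "ds_reachable A l\<^sub>g"
      using calls[OF c] unfolding sound_dart_def ds_reachable_iff by blast
    then show ?thesis
      using Returned \<open>b\<close> by simp
  next
    case (Running PW')
    note run = run_calls_Running[OF Running]
    have called: "k \<noteq> l\<^sub>g \<and> (\<exists>u' q'. PW' (k, \<beta>) = Some (u', q') \<and> u' \<le> u \<and> q' \<le> q)"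
      if "(k, \<beta>, u, q) \<in> set ?cs" for k \<beta> u q
      using run[THEN conjunct2, THEN conjunct1, rule_format, OF that] by simp
    note origin = run[THEN conjunct2, THEN conjunct2, rule_format]
    have "pw_le ?PW1 PW"
      using PW by (auto simp: pw_le_def)
    with run[THEN conjunct1] have le: "pw_le PW' PW"
      by (rule pw_le_trans)
    have "pw_sound A l\<^sub>g PW'"
      unfolding pw_sound_def
    proof (intro allI impI)
      fix k \<beta> u q
      assume "PW' (k, \<beta>) = Some (u, q)"
      then have "\<exists>q. ?PW1 (k, \<beta>) = Some (u, q) \<or> (k, \<beta>, u, q) \<in> set ?cs"
        by (rule origin[THEN conjunct1])
      \<comment> \<open>Overwriting the picked entry keeps its lower bound, so the origin can be
        sought in \<open>PW\<close> itself.\<close>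
      then consider q where "PW (k, \<beta>) = Some (u, q)" | q where "(k, \<beta>, u, q) \<in> set ?cs"
        using PW by (auto split: if_splits)
      then show "k \<noteq> l\<^sub>g \<and> sound_dart A k \<beta> u"
      proof cases
        case 1
        then show ?thesis
          using sound unfolding pw_sound_def by blast
      next
        case 2
        then show ?thesis
          using called[OF 2] calls[OF 2] by blast
      qed
    qed
    moreover have "pw_complete A PW'"
      unfolding pw_complete_def
    proof (intro conjI allI impI)
      show "covered (max_const A) PW' (init_loc A) (\<lambda>_. 0)"
        using complete covered_mono[OF le] unfolding pw_complete_def by blast
    next
      fix k \<beta> u q n g R k'
      assume PW': "PW' (k, \<beta>) = Some (u, q)" and qn: "q \<le> enat n"
        and e: "(k, g, R, k') \<in> edges A" and sat: "sat (delay \<beta> n) g"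
      have "\<exists>u. ?PW1 (k, \<beta>) = Some (u, q) \<or> (k, \<beta>, u, q) \<in> set ?cs"
        using PW' by (rule origin[THEN conjunct2])
      \<comment> \<open>All calls carry an infinite upper bound, so a finite \<open>q\<close> was in
        the list before them.\<close>
      moreover have "q \<noteq> \<infinity>"
        using qn by (cases q) auto
      ultimately obtain u' where "?PW1 (k, \<beta>) = Some (u', q)"
        using calls by blast
      \<comment> \<open>The picked dart falls under \<open>explored\<close> when
        \<open>p \<le> enat n\<close>, and under \<open>current\<close> otherwise.\<close>
      then consider (explored) u' q' where "PW (k, \<beta>) = Some (u', q')" "q' \<le> enat n"
        | (current) "k = l" "\<beta> = \<alpha>" "w \<le> n" "enat n < p"
      proof (cases "(k, \<beta>) = (l, \<alpha>) \<and> enat n < p")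
        case True
        \<comment> \<open>The overwritten entry is \<open>(w, enat w)\<close>, hence
          \<open>q = enat w\<close>.\<close>
        moreover have "w \<le> n"
          using True \<open>?PW1 (k, \<beta>) = Some (u', q)\<close> qn by auto
        ultimately show ?thesis
          using that(2) by blast
      next
        case False
        have "\<exists>u' q'. PW (k, \<beta>) = Some (u', q') \<and> q' \<le> enat n"
        proof (cases "(k, \<beta>) = (l, \<alpha>)")
          case True
          then show ?thesis
            using PW(1) False not_less by auto
        next
          case False
          then show ?thesis
            using \<open>?PW1 (k, \<beta>) = Some (u', q)\<close> qn by (simp split: if_splits)
        qed
        then show ?thesis
          using that(1) by blast
      qed
      then show "covered (max_const A) PW' k' (reset (delay \<beta> n) R)"
      proof cases
        case explored
        then have "covered (max_const A) PW k' (reset (delay \<beta> n) R)"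
          by (rule complete[unfolded pw_complete_def, THEN conjunct2, rule_format, OF _ _ e sat])
        then show ?thesis
          by (rule covered_mono[OF le])
      next
        case current
        have "w \<le> max_const A"
          using dart by (simp add: sound_dart_def)
        then have "dart_start g \<alpha> w \<le> max_const A"
          using max_const_ge(1)[OF A e] by (simp add: dart_start_le_iff trans_le_add2)
        from edge_calls_complete[OF current(3,4) sat[unfolded current(2)] this, of k' l R]
        obtain \<gamma> t r m
          where c: "(k', \<gamma>, t, r) \<in> set (edge_calls (max_const A) \<alpha> w p (l, g, R, k'))"
            and m: "t \<le> m" "cap_eq (Suc (max_const A)) (reset (delay \<alpha> n) R) (delay \<gamma> m)"
          by blast
        have "(l, g, R, k') \<in> set es"
          using e es current(1) by simp
        with c have "(k', \<gamma>, t, r) \<in> set ?cs"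
          unfolding set_concat set_map by blast
        from called[OF this] obtain t' r' where "PW' (k', \<gamma>) = Some (t', r')" "t' \<le> t"
          by blast
        moreover have "t' \<le> m"
          using \<open>t' \<le> t\<close> m(1) by simp
        ultimately show ?thesis
          using m(2) current(2) unfolding covered_def by blast
      qed
    qed
    ultimately show ?thesis
      using Running by simp
  qed
qed

lemma config_inv_step:
  fixes A :: "('l::finite, 'c::finite) ta"
  assumes A: "timed_automaton A" and "alg_step A l\<^sub>g s s'" and inv: "config_inv A l\<^sub>g s"
  shows "config_inv A l\<^sub>g s'"
  using assms(2)
proof cases
  case (iterate PW l \<alpha> w p es)
  then show ?thesis
    using config_inv_iterate[OF A] inv by blast
next
  case (exit PW)
  \<comment> \<open>A reachable goal would be covered by an entry at \<open>l\<^sub>g\<close>, which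
    \<open>pw_sound\<close> excludes.\<close>
  have "\<not> ds_state A l\<^sub>g v" for v
  proof
    assume "ds_state A l\<^sub>g v"
    then have "covered (max_const A) PW l\<^sub>g v"
      using covered_if_ds_state[OF A _ exit(3)] inv exit(1) by simp
    then show False
      using inv exit(1) by (auto simp: covered_def pw_sound_def)
  qed
  then show ?thesis
    using exit by (simp add: ds_reachable_iff)
qed

lemma config_inv_reaches:
  fixes A :: "('l::finite, 'c::finite) ta"
  assumes "timed_automaton A" "alg_reaches A l\<^sub>g s"
  shows "config_inv A l\<^sub>g s"
  using assms(2)[unfolded alg_reaches_def]
  by (induction rule: rtranclp_induct) (auto intro: config_inv_init config_inv_step[OF assms(1)])

section \<open>Termination\<close>

text \<open>The cap makes infinite upper bounds finite; a missing entry gets the largest value, so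
  insertion never raises the measure.\<close>

definition entry_measure :: "nat \<Rightarrow> (nat \<times> enat) option \<Rightarrow> nat" where
  "entry_measure K e = (case e of None \<Rightarrow> K + K
     | Some (w, p) \<Rightarrow> min w K + the_enat (min p (enat K)))"

definition pw_measure :: "nat \<Rightarrow> ('l::finite, 'c::finite) pw_list \<Rightarrow> nat" where
  "pw_measure K PW = (\<Sum>k \<in> UNIV \<times> {\<alpha>. \<forall>x. \<alpha> x \<le> K}. entry_measure K (PW k))"

lemma the_enat_min_mono: "p \<le> q \<Longrightarrow> the_enat (min p (enat K)) \<le> the_enat (min q (enat K))"
  by (cases p; cases q) (auto simp: min_def)

lemma entry_measure_mono:
  assumes "pw_le PW' PW"
  shows "entry_measure K (PW' k) \<le> entry_measure K (PW k)"
proof (cases "PW k")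
  case None
  have "the_enat (min p (enat K)) \<le> K" for p
    using the_enat_min_mono[of p \<infinity> K] by simp
  then have "entry_measure K e \<le> K + K" for e
    by (auto simp: entry_measure_def add_mono split: option.split)
  then show ?thesis
    using None by (simp add: entry_measure_def)
next
  case (Some e)
  obtain w p where e: "e = (w, p)"
    by (cases e)
  then obtain w' p' where "PW' k = Some (w', p')" "w' \<le> w" "p' \<le> p"
    using assms Some unfolding pw_le_def by blast
  then show ?thesis
    using Some e the_enat_min_mono[of p' p K]
    by (auto simp: entry_measure_def intro!: add_mono)
qed

lemma finite_bounded_valuations: "finite {\<alpha> :: 'c::finite valuation. \<forall>x. \<alpha> x \<le> K}"
  using finite_set_of_finite_funs[of "UNIV :: 'c set" "{..K}" 0] by simp

lemma pw_measure_mono: "pw_le PW' PW \<Longrightarrow> pw_measure K PW' \<le> pw_measure K PW"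
  unfolding pw_measure_def by (intro sum_mono entry_measure_mono)

text \<open>With \<open>w < K\<close>, the drop of the upper bound to \<open>w\<close> is visible
  below the cap.\<close>

lemma pw_measure_update:
  fixes PW :: "('l::finite, 'c::finite) pw_list"
  assumes PW: "PW (l, \<alpha>) = Some (w, p)" "enat w < p" and \<alpha>: "\<forall>x. \<alpha> x \<le> K" and w: "w < K"
  shows "pw_measure K (PW((l, \<alpha>) := Some (w, enat w))) < pw_measure K PW"
  unfolding pw_measure_def
proof (rule sum_strict_mono_ex1)
  let ?PW1 = "PW((l, \<alpha>) := Some (w, enat w))"
  show "finite (UNIV \<times> {\<alpha>. \<forall>x. \<alpha> x \<le> K} :: ('l \<times> 'c valuation) set)"
    by (intro finite_cartesian_product finite_bounded_valuations) simp
  have "pw_le ?PW1 PW"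
    using PW by (auto simp: pw_le_def)
  then show "\<forall>k \<in> UNIV \<times> {\<alpha>. \<forall>x. \<alpha> x \<le> K}. entry_measure K (?PW1 k) \<le> entry_measure K (PW k)"
    by (intro ballI entry_measure_mono)
  have "entry_measure K (?PW1 (l, \<alpha>)) < entry_measure K (PW (l, \<alpha>))"
    using PW w by (cases p) (auto simp: entry_measure_def min_def)
  then show "\<exists>k \<in> UNIV \<times> {\<alpha>. \<forall>x. \<alpha> x \<le> K}. entry_measure K (?PW1 k) < entry_measure K (PW k)"
    using \<alpha> by blast
qed

text \<open>Overwriting the picked entry lowers the measure strictly, and the calls that follow
  cannot raise it.\<close>

lemma pw_measure_step:
  fixes A :: "('l::finite, 'c::finite) ta"
  assumes inv: "config_inv A l\<^sub>g (Running PW)" and step: "alg_step A l\<^sub>g (Running PW) (Running PW')"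
  shows "pw_measure (Suc (max_const A)) PW' < pw_measure (Suc (max_const A)) PW"
  using step
proof cases
  case (iterate l \<alpha> w p es)
  have "sound_dart A l \<alpha> w"
    using inv iterate by (auto simp: pw_sound_def)
  then have "pw_measure (Suc (max_const A)) (PW((l, \<alpha>) := Some (w, enat w)))
      < pw_measure (Suc (max_const A)) PW"
    using iterate by (intro pw_measure_update) (auto simp: sound_dart_def)
  moreover have "pw_le PW' (PW((l, \<alpha>) := Some (w, enat w)))"
    by (rule run_calls_Running[OF iterate(1)[symmetric], THEN conjunct1])
  then have "pw_measure (Suc (max_const A)) PW'
      \<le> pw_measure (Suc (max_const A)) (PW((l, \<alpha>) := Some (w, enat w)))"
    by (rule pw_measure_mono)
  ultimately show ?thesis
    by linarith
qed

lemma alg_terminates_if_timed_automaton: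
  fixes A :: "('l::finite, 'c::finite) ta"
  assumes A: "timed_automaton A"
  shows "alg_terminates A l\<^sub>g"
  unfolding alg_terminates_def
proof (rule notI, elim exE conjE)
  fix \<rho>
  assume init: "\<rho> 0 = alg_init A l\<^sub>g" and step: "\<forall>i::nat. alg_step A l\<^sub>g (\<rho> i) (\<rho> (Suc i))"
  have inv: "config_inv A l\<^sub>g (\<rho> i)" for i
  proof (induction i)
    case 0
    show ?case
      using init config_inv_init[of A l\<^sub>g] by simp
  next
    case (Suc i)
    then show ?case
      using config_inv_step[OF A step[rule_format]] by blast
  qed
  \<comment> \<open>A returned configuration has no successor, so an infinite run never contains
    one.\<close>
  have "\<exists>PW. \<rho> i = Running PW" for i
    using step[rule_format, of i] by cases auto
  then obtain f where f: "\<And>i. \<rho> i = Running (f i)"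
    by metis
  have "(f (Suc i), f i) \<in> measure (pw_measure (Suc (max_const A)))" for i
    using pw_measure_step[of A l\<^sub>g "f i" "f (Suc i)"] inv[of i] step[rule_format, of i] f by simp
  then show False
    using wf_measure unfolding wf_iff_no_infinite_down_chain by blast
qed

section \<open>Final configurations\<close>

lemma Running_not_final:
  fixes A :: "('l::finite, 'c::finite) ta"
  assumes "timed_automaton A"
  shows "\<not> alg_final A l\<^sub>g (Running PW)"
proof (cases "\<exists>l \<alpha> w p. PW (l, \<alpha>) = Some (w, p) \<and> enat w < p")
  case True
  then obtain l \<alpha> w p where PW: "PW (l, \<alpha>) = Some (w, p)" "enat w < p"
    by blast
  \<comment> \<open>An iteration needs a list enumerating the outgoing edges, which exists because
    they are finite in number.\<close>
  have "finite {e \<in> edges A. fst e = l}"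
    using assms by (simp add: timed_automaton_def)
  from finite_distinct_list[OF this]
  obtain es where "set es = {e \<in> edges A. fst e = l}" "distinct es"
    by blast
  from alg_step.iterate[of PW l \<alpha> w p es A, OF PW this(2,1)] show ?thesis
    unfolding alg_final_def by blast
next
  case False
  from alg_step.exit[of PW, OF this] show ?thesis
    unfolding alg_final_def by blast
qed

theorem theorem3:
  fixes A :: "('l::finite, 'c::finite) ta" and l\<^sub>g :: 'l
  assumes "timed_automaton A"
  shows "alg_terminates A l\<^sub>g \<and>
    (\<forall>s. alg_reaches A l\<^sub>g s \<and> alg_final A l\<^sub>g s \<longrightarrow> s = Returned (ds_reachable A l\<^sub>g)) \<and>
    (\<forall>PW. alg_reaches A l\<^sub>g (Running PW) \<longrightarrow> dom PW \<subseteq> UNIV \<times> anchor_points)"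
proof (intro conjI allI impI)
  show "alg_terminates A l\<^sub>g"
    using assms by (rule alg_terminates_if_timed_automaton)
next
  fix s
  assume s: "alg_reaches A l\<^sub>g s \<and> alg_final A l\<^sub>g s"
  then have "config_inv A l\<^sub>g s"
    using config_inv_reaches[OF assms] by blast
  then show "s = Returned (ds_reachable A l\<^sub>g)"
    using s Running_not_final[OF assms] by (cases s) auto
next
  fix PW
  assume "alg_reaches A l\<^sub>g (Running PW)"
  then have "config_inv A l\<^sub>g (Running PW)"
    using config_inv_reaches[OF assms] by blast
  then show "dom PW \<subseteq> UNIV \<times> anchor_points"
    by (auto simp: pw_sound_def sound_dart_def)
qed

end
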